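(* If $G$ and $H$ are connected graphs, then (i) $\mu(G\,\square\, H) \le \min\{\mu(G)\,n(H),\ \mu(H)\,n(G)\}$, and (ii) $\mu(G\,\square\, H) \ge \max\{\mu(G)\,\mu_i(H),\ \mu(H)\,\mu_i(G)\}$.
   Context: All graphs are finite, simple, undirected and connected; $n(G)=|V(G)|$. For $X\subseteq V(G)$, two vertices $x,y\in X$ are $X$-visible if there is a shortest $x,y$-path $P$ in $G$ with $V(P)\cap X=\{x,y\}$; $X$ is a mutual-visibility set if all pairs of its vertices are $X$-visible. $\mu(G)$ is the largest size of a mutual-visibility set of $G$. A mutual-visibility set $X$ is independent if no two vertices of $X$ are adjacent; $\mu_i(G)$ is the largest size of an independent mutual-visibility set. The Cartesian product $G\,\square\, H$ has vertex set $V(G)\times V(H)$, with $(g,h)(g',h')$ an edge iff either $gg'\in E(G)$ and $h=h'$, or $g=g'$ and $hh'\in E(H)$. *)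

theory Defs
  imports
    "Graph_Theory.Pair_Digraph"
    "Graph_Theory.Digraph_Component_Vwalk"
begin

text \<open>
  A finite simple undirected graph is a \<^locale>\<open>pair_graph\<close>: every edge is represented by
  both of its orientations. The order of such a graph is the cardinality of its vertex set.
  Connectedness is \<^const>\<open>Digraph_Component.connected\<close>, which includes that the vertex set is
  nonempty.
\<close>

definition shortest_vpath :: "'a pair_pre_digraph \<Rightarrow> 'a \<Rightarrow> 'a \<Rightarrow> 'a vwalk \<Rightarrow> bool" where
  "shortest_vpath G x y p \<longleftrightarrow>
     vpath p (with_proj G) \<and> hd p = x \<and> last p = y \<and>
     (\<forall>q. vpath q (with_proj G) \<and> hd q = x \<and> last q = y \<longrightarrow> vwalk_length p \<le> vwalk_length q)"

definition visible :: "'a pair_pre_digraph \<Rightarrow> 'a set \<Rightarrow> 'a \<Rightarrow> 'a \<Rightarrow> bool" where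
  "visible G X x y \<longleftrightarrow> (\<exists>p. shortest_vpath G x y p \<and> set p \<inter> X = {x, y})"

text \<open>
  The pairs with \<open>x = y\<close> need not be excluded: the one-vertex path always witnesses them.
\<close>

definition mutual_visibility_set :: "'a pair_pre_digraph \<Rightarrow> 'a set \<Rightarrow> bool" where
  "mutual_visibility_set G X \<longleftrightarrow> X \<subseteq> pverts G \<and> (\<forall>x\<in>X. \<forall>y\<in>X. visible G X x y)"

definition independent_mutual_visibility_set :: "'a pair_pre_digraph \<Rightarrow> 'a set \<Rightarrow> bool" where
  "independent_mutual_visibility_set G X \<longleftrightarrow>
     mutual_visibility_set G X \<and> (\<forall>x\<in>X. \<forall>y\<in>X. (x, y) \<notin> parcs G)"

definition mu :: "'a pair_pre_digraph \<Rightarrow> nat" where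
  "mu G = Max (card ` {X. mutual_visibility_set G X})"

definition mu_i :: "'a pair_pre_digraph \<Rightarrow> nat" where
  "mu_i G = Max (card ` {X. independent_mutual_visibility_set G X})"

definition cartesian_product ::
  "'a pair_pre_digraph \<Rightarrow> 'b pair_pre_digraph \<Rightarrow> ('a \<times> 'b) pair_pre_digraph" where
  "cartesian_product G H =
     \<lparr> pverts = pverts G \<times> pverts H,
       parcs = {((g, h), (g', h')) | g h g' h'.
          (g, g') \<in> parcs G \<and> h \<in> pverts H \<and> h = h' \<or>
          g \<in> pverts G \<and> g = g' \<and> (h, h') \<in> parcs H} \<rparr>"

lemma pair_graph_cartesian_product:
  assumes "pair_graph G" "pair_graph H"
  shows "pair_graph (cartesian_product G H)"
proof -
  interpret G: pair_graph G by fact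
  interpret H: pair_graph H by fact
  let ?P = "cartesian_product G H"
  have sub: "parcs ?P \<subseteq> pverts ?P \<times> pverts ?P"
    using G.wellformed' H.wellformed' by (auto simp: cartesian_product_def)
  have fin: "finite (pverts ?P)"
    using G.pair_finite_verts H.pair_finite_verts by (auto simp: cartesian_product_def)
  have "finite (parcs ?P)"
    using sub fin by (meson finite_SigmaI finite_subset)
  moreover have "symmetric (with_proj ?P)"
    using G.pair_sym_arcs H.pair_sym_arcs
    by (auto simp: symmetric_def cartesian_product_def intro!: symI dest: symD)
  moreover have "fst e \<noteq> snd e" if "e \<in> parcs ?P" for e
    using that G.pair_no_loops H.pair_no_loops by (force simp: cartesian_product_def)
  ultimately show ?thesis
    using sub fin by unfold_locales auto
qed

text \<open>The maxima defining \<open>mu\<close> and \<open>mu_i\<close> range over finite nonempty sets.\<close>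

lemma mutual_visibility_cards:
  assumes "finite (pverts G)"
  shows "finite (card ` {X. mutual_visibility_set G X})"
    and "card ` {X. mutual_visibility_set G X} \<noteq> {}"
    and "finite (card ` {X. independent_mutual_visibility_set G X})"
    and "card ` {X. independent_mutual_visibility_set G X} \<noteq> {}"
proof -
  have "{X. mutual_visibility_set G X} \<subseteq> Pow (pverts G)"
    "{X. independent_mutual_visibility_set G X} \<subseteq> Pow (pverts G)"
    by (auto simp: mutual_visibility_set_def independent_mutual_visibility_set_def)
  then show "finite (card ` {X. mutual_visibility_set G X})"
    and "finite (card ` {X. independent_mutual_visibility_set G X})"
    using assms by (meson finite_Pow_iff finite_imageI finite_subset)+
  have "independent_mutual_visibility_set G {}"
    by (simp add: mutual_visibility_set_def independent_mutual_visibility_set_def)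
  then show "card ` {X. mutual_visibility_set G X} \<noteq> {}"
    and "card ` {X. independent_mutual_visibility_set G X} \<noteq> {}"
    by (auto simp: independent_mutual_visibility_set_def)
qed

end

theory Submission
  imports Defs
begin

text \<open>
  Shortest walks add up in a Cartesian product: every walk projects to a pair of walks in the
  factors whose lengths sum to its own, so distances are sums of distances.

  For the upper bound, a shortest walk between two vertices of one layer stays in that layer; hence
  each layer of a mutual-visibility set is a mutual-visibility set of the factor.

  For the lower bound, take a mutual-visibility set \<open>S\<close> of \<open>G\<close> and an independent one \<open>I\<close> of \<open>H\<close>.
  Distinct \<open>h\<close>, \<open>h'\<close> in \<open>I\<close> are not adjacent, so a shortest path witnessing their visibility has
  an inner vertex \<open>k\<close> next to \<open>h\<close>, and \<open>k\<close> is not in \<open>I\<close>. Moving from \<open>h\<close> to \<open>k\<close>, then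
  through \<open>G\<close> inside layer \<open>k\<close>, then from \<open>k\<close> to \<open>h'\<close> avoids \<open>S \<times> I\<close>.
\<close>

section \<open>Shortest paths as shortest walks\<close>

lemma length_vwalk_to_vpath_le: "length (vwalk_to_vpath p) \<le> length p"
  by (induct p rule: vwalk_to_vpath_induct3)
    (auto intro: order_trans length_dropWhile_le le_SucI)

text \<open>If the head recurs, the recursion jumps to its next occurrence and loses at least the
  head; otherwise the repetition lies in the tail and induction applies.\<close>

lemma length_vwalk_to_vpath_less:
  "\<not> distinct p \<Longrightarrow> length (vwalk_to_vpath p) < length p"
proof (induct p)
  case (Cons x xs)
  have "length (vwalk_to_vpath (dropWhile (\<lambda>y. y \<noteq> x) xs)) \<le> length xs"
    by (meson length_vwalk_to_vpath_le length_dropWhile_le order_trans)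
  with Cons show ?case by auto
qed simp

text \<open>Shortcutting a walk to a path keeps its ends and never lengthens it, so minimality among
  paths extends to walks; a shortest walk repeats no vertex, since shortcutting would shorten it.
  Later constructions therefore need only a walk of the right length, with vertices counted instead
  of edges.\<close>

lemma shortest_vpath_iff:
  "shortest_vpath G x y p \<longleftrightarrow>
     vwalk p (with_proj G) \<and> hd p = x \<and> last p = y \<and>
     (\<forall>q. vwalk q (with_proj G) \<and> hd q = x \<and> last q = y \<longrightarrow> length p \<le> length q)"
  (is "_ \<longleftrightarrow> ?R")
proof
  assume p: "shortest_vpath G x y p"
  have "length p \<le> length q"
    if q: "vwalk q (with_proj G)" "hd q = x" "last q = y" for q
  proof -
    have "length p - 1 \<le> length (vwalk_to_vpath q) - 1"
      using p q vwalk_to_vpath_vpath[OF q(1)]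
      by (auto simp: shortest_vpath_def vwalk_to_vpath_hd vwalk_to_vpath_last)
    \<comment> \<open>Nonemptiness undoes the truncated subtraction in the edge counts.\<close>
    moreover have "q \<noteq> []" "vwalk_to_vpath q \<noteq> []"
      using q vwalk_to_vpath_nonempty[of q] by auto
    ultimately show ?thesis
      using length_vwalk_to_vpath_le[of q]
      by (cases q; cases "vwalk_to_vpath q") auto
  qed
  with p show ?R by (auto simp: shortest_vpath_def)
next
  assume p: ?R
  then have "length p \<le> length (vwalk_to_vpath p)"
    using vwalk_to_vpath_vpath[of p "with_proj G"]
    by (auto simp: vwalk_to_vpath_hd vwalk_to_vpath_last)
  then have "distinct p"
    using length_vwalk_to_vpath_less[of p] by linarith
  with p show "shortest_vpath G x y p"
    by (auto simp: shortest_vpath_def vpath_def intro!: diff_le_mono)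
qed

section \<open>Walks in the Cartesian product\<close>

lemma cartesian_product_simps [simp]:
  "pverts (cartesian_product G H) = pverts G \<times> pverts H"
  "((g, h), (g', h')) \<in> parcs (cartesian_product G H) \<longleftrightarrow>
     (g, g') \<in> parcs G \<and> h \<in> pverts H \<and> h = h' \<or>
     g \<in> pverts G \<and> g = g' \<and> (h, h') \<in> parcs H"
  by (auto simp: cartesian_product_def)

lemma vwalk_arcs_map: "vwalk_arcs (map f p) = map (map_prod f f) (vwalk_arcs p)"
  by (induct p rule: vwalk_arcs.induct) auto

lemma vwalk_map:
  assumes "vwalk p (with_proj G)"
    and "\<And>v. v \<in> pverts G \<Longrightarrow> f v \<in> pverts K"
    and "\<And>u v. (u, v) \<in> parcs G \<Longrightarrow> (f u, f v) \<in> parcs K"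
  shows "vwalk (map f p) (with_proj K)"
  using assms by (fastforce simp: vwalk_def vwalk_arcs_map)

lemma vwalk_append:
  assumes "vwalk p K" "vwalk q K" "(last p, hd q) \<in> arcs_ends K"
  shows "vwalk (p @ q) K"
  using assms by (auto simp: vwalk_def vwalk_arcs_append)

lemma vwalk_layer_fst:
  assumes "vwalk p (with_proj G)" "h \<in> pverts H"
  shows "vwalk (map (\<lambda>g. (g, h)) p) (with_proj (cartesian_product G H))"
  using assms by (auto intro: vwalk_map)

lemma vwalk_layer_snd:
  assumes "vwalk q (with_proj H)" "g \<in> pverts G"
  shows "vwalk (map (Pair g) q) (with_proj (cartesian_product G H))"
  using assms by (auto intro: vwalk_map)

text \<open>Each step of \<open>w\<close> moves exactly one coordinate, so it prepends a vertex to
  exactly one of the two projections. The \<open>Suc\<close> arises because lengths count vertices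
  and the start is counted in both factors.\<close>

lemma vwalk_cartesian_product_project:
  assumes "vwalk w (with_proj (cartesian_product G H))"
    and "pair_graph G" "pair_graph H"
  obtains p q where "vwalk p (with_proj G)" "vwalk q (with_proj H)"
    "hd w = (hd p, hd q)" "last w = (last p, last q)"
    "length p + length q = Suc (length w)"
    "set p = fst ` set w" "set q = snd ` set w"
proof -
  interpret G: pair_graph G by fact
  interpret H: pair_graph H by fact
  have "\<exists>p q. vwalk p (with_proj G) \<and> vwalk q (with_proj H) \<and>
    hd w = (hd p, hd q) \<and> last w = (last p, last q) \<and>
    length p + length q = Suc (length w) \<and> set p = fst ` set w \<and> set q = snd ` set w"
    using assms(1)
  proof (induct w)
    case (Base u)
    obtain g h where "u = (g, h)" by fastforce
    then show ?case
      using Base by (intro exI[of _ "[g]"] exI[of _ "[h]"]) (auto simp: vwalk_def)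
  next
    case (Cons u v w)
    then obtain p q where pq: "vwalk p (with_proj G)" "vwalk q (with_proj H)"
      "v = (hd p, hd q)" "last (v # w) = (last p, last q)"
      "length p + length q = Suc (length (v # w))"
      "set p = fst ` set (v # w)" "set q = snd ` set (v # w)"
      by auto
    obtain g h where u: "u = (g, h)" by fastforce
    have ne: "p \<noteq> []" "q \<noteq> []" using pq by auto
    from Cons u pq(3) consider "(g, hd p) \<in> parcs G" "h = hd q"
      | "g = hd p" "(h, hd q) \<in> parcs H"
      by auto
    then show ?case
    proof cases
      case 1
      then have "vwalk (g # p) (with_proj G)"
        using pq(1) G.wellformed' by (auto intro!: vwalk_consI)
      with 1 pq ne u show ?thesis
        by (intro exI[of _ "g # p"] exI[of _ q]) auto
    next
      case 2
      then have "vwalk (h # q) (with_proj H)"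
        using pq(2) H.wellformed' by (auto intro!: vwalk_consI)
      with 2 pq ne u show ?thesis
        by (intro exI[of _ p] exI[of _ "h # q"]) auto
    qed
  qed
  with that show thesis by blast
qed

text \<open>Any competitor projects to walks at least as long as \<open>p\<close> and
  \<open>q\<close>, so a walk attaining their combined length is optimal.\<close>

lemma shortest_vpath_cartesian_productI:
  assumes "pair_graph G" "pair_graph H"
    and "shortest_vpath G g g' p" "shortest_vpath H h h' q"
    and "vwalk w (with_proj (cartesian_product G H))"
    and "hd w = (g, h)" "last w = (g', h')" "Suc (length w) = length p + length q"
  shows "shortest_vpath (cartesian_product G H) (g, h) (g', h') w"
  unfolding shortest_vpath_iff
proof (intro conjI allI impI assms)
  fix r
  assume r: "vwalk r (with_proj (cartesian_product G H)) \<and> hd r = (g, h) \<and> last r = (g', h')"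
  then obtain p' q' where "vwalk p' (with_proj G)" "vwalk q' (with_proj H)"
    "hd r = (hd p', hd q')" "last r = (last p', last q')"
    "length p' + length q' = Suc (length r)"
    using assms(1,2) by (auto elim: vwalk_cartesian_product_project)
  moreover from this r have "length p \<le> length p'" "length q \<le> length q'"
    using assms(3,4) by (auto simp: shortest_vpath_iff)
  ultimately show "length w \<le> length r"
    using assms(8) by linarith
qed

section \<open>Layers and products of mutual-visibility sets\<close>

lemma mutual_visibility_set_layer:
  assumes "pair_graph G" "pair_graph H"
    and X: "mutual_visibility_set (cartesian_product G H) X"
  shows "mutual_visibility_set G {g. (g, h) \<in> X}" (is "mutual_visibility_set G ?L")
  unfolding mutual_visibility_set_def
proof (intro conjI ballI)
  show "?L \<subseteq> pverts G"
    using X by (auto simp: mutual_visibility_set_def)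
  fix g g' assume g: "g \<in> ?L" "g' \<in> ?L"
  then have h: "h \<in> pverts H"
    using X by (auto simp: mutual_visibility_set_def)
  obtain w where w: "shortest_vpath (cartesian_product G H) (g, h) (g', h) w"
    "set w \<inter> X = {(g, h), (g', h)}"
    using X g unfolding mutual_visibility_set_def visible_def by fastforce
  then obtain p q where pq: "vwalk p (with_proj G)" "vwalk q (with_proj H)"
    "hd w = (hd p, hd q)" "last w = (last p, last q)"
    "length p + length q = Suc (length w)"
    "set p = fst ` set w" "set q = snd ` set w"
    using assms(1,2) by (auto simp: shortest_vpath_iff elim: vwalk_cartesian_product_project)
  have ends: "hd p = g" "last p = g'" "hd q = h"
    using w(1) pq by (auto simp: shortest_vpath_iff)
  have ne: "p \<noteq> []" "q \<noteq> []" using pq by auto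
  \<comment> \<open>A walk of \<open>G\<close> lifted into layer \<open>h\<close> competes with
    \<open>w\<close>. Applied to \<open>p\<close>, this leaves room for only one vertex in
    \<open>q\<close>; once \<open>w\<close> and \<open>p\<close> have equal length, it is the
    minimality of \<open>p\<close>.\<close>
  have le: "length w \<le> length r"
    if "vwalk r (with_proj G)" "hd r = g" "last r = g'" for r
  proof -
    have "r \<noteq> []" using that by auto
    then show ?thesis
      using w(1) that vwalk_layer_fst[OF that(1) h]
      unfolding shortest_vpath_iff
      by (metis (no_types, lifting) hd_map last_map length_map)
  qed
  have "length q \<le> 1" using le[of p] pq ends by linarith
  then have q: "q = [h]" using ne ends by (cases q) auto
  have "shortest_vpath G g g' p"
    using pq ends le q by (auto simp: shortest_vpath_iff)
  moreover have "set p \<inter> ?L = {g, g'}"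
  proof
    show "{g, g'} \<subseteq> set p \<inter> ?L" using g ends ne by auto
    show "set p \<inter> ?L \<subseteq> {g, g'}"
    proof
      fix a assume a: "a \<in> set p \<inter> ?L"
      then obtain b where "(a, b) \<in> set w" using pq(6) by auto
      moreover from this have "b = h" using pq(7) q by force
      ultimately have "(a, h) \<in> set w \<inter> X" using a by auto
      with w(2) show "a \<in> {g, g'}" by auto
    qed
  qed
  ultimately show "visible G ?L g g'" by (auto simp: visible_def)
qed

lemma mutual_visibility_set_Times:
  assumes "pair_graph G" "pair_graph H"
    and S: "mutual_visibility_set G S" and I: "independent_mutual_visibility_set H I"
  shows "mutual_visibility_set (cartesian_product G H) (S \<times> I)"
  unfolding mutual_visibility_set_def
proof (intro conjI ballI)
  have sub: "S \<subseteq> pverts G" "I \<subseteq> pverts H"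
    using S I by (auto simp: mutual_visibility_set_def independent_mutual_visibility_set_def)
  then show "S \<times> I \<subseteq> pverts (cartesian_product G H)" by auto
  fix x y assume xy: "x \<in> S \<times> I" "y \<in> S \<times> I"
  obtain g h g' h' where x: "x = (g, h)" and y: "y = (g', h')" by fastforce
  have mem: "g \<in> S" "h \<in> I" "g' \<in> S" "h' \<in> I" using xy x y by auto
  obtain p where p: "shortest_vpath G g g' p" "set p \<inter> S = {g, g'}"
    using S mem unfolding mutual_visibility_set_def visible_def by blast
  obtain q where q: "shortest_vpath H h h' q" "set q \<inter> I = {h, h'}"
    using I mem
    unfolding independent_mutual_visibility_set_def mutual_visibility_set_def visible_def by blast
  have vp: "vwalk p (with_proj G)" "hd p = g" "last p = g'" "p \<noteq> []"
    and vq: "vwalk q (with_proj H)" "hd q = h" "last q = h'" "q \<noteq> []"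
    using p(1) q(1) by (auto simp: shortest_vpath_iff)
  have dist: "distinct q" using q(1) by (auto simp: shortest_vpath_def)
  show "visible (cartesian_product G H) (S \<times> I) x y"
  proof (cases "h = h'")
    case True
    let ?w = "map (\<lambda>a. (a, h)) p"
    \<comment> \<open>The one-vertex walk \<open>[h]\<close> competes with \<open>q\<close>.\<close>
    have "length q \<le> length [h]"
      using True mem sub
      by (intro q(1)[unfolded shortest_vpath_iff, THEN conjunct2, THEN conjunct2,
            THEN conjunct2, rule_format]) (auto simp: vwalk_def)
    then have "length q = 1" using vq(4) by (cases q) auto
    then have "shortest_vpath (cartesian_product G H) (g, h) (g', h') ?w"
      using vp mem sub True vwalk_layer_fst[OF vp(1), of h H]
      by (intro shortest_vpath_cartesian_productI[OF assms(1,2) p(1) q(1)])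
        (auto simp: hd_map last_map)
    moreover have "set ?w \<inter> S \<times> I = {(g, h), (g', h')}"
      using p(2) True mem by auto
    ultimately show ?thesis unfolding visible_def x y by blast
  next
    case False
    then obtain k r where q_eq: "q = h # k # r"
      using vq by (cases q; cases "tl q") auto
    then have arc: "(h, k) \<in> parcs H" using vq(1) by (auto simp: vwalk_def)
    moreover have "(h, h') \<notin> parcs H"
      using I mem by (auto simp: independent_mutual_visibility_set_def)
    \<comment> \<open>If \<open>r\<close> were empty, \<open>k\<close> would be \<open>h'\<close>,
      and the arc from \<open>h\<close> to \<open>k\<close> would contradict the independence of
      \<open>I\<close>.\<close>
    ultimately have r: "r \<noteq> []" "last r = h'"
      using vq(3) q_eq by (auto split: if_splits)
    \<comment> \<open>A member of \<open>I\<close> on \<open>q\<close> is \<open>h\<close> or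
      \<open>h'\<close>; \<open>k\<close> is neither, as \<open>q\<close> is distinct and
      \<open>h'\<close> is the last vertex of \<open>r\<close>.\<close>
    then have k: "k \<notin> I" "k \<in> pverts H" and h: "h \<notin> set r"
      using dist q(2) q_eq vq(1) by (auto simp: vwalk_def)
    have "vwalk (h # k # r) (with_proj H)" using vq(1) q_eq by simp
    then have vr: "vwalk r (with_proj H)" and arc': "(k, hd r) \<in> parcs H"
      using r(1) by (cases r; auto simp: vwalk_def)+
    let ?P = "map (\<lambda>a. (a, k)) p" and ?R = "map (Pair g') r"
    \<comment> \<open>The walk traverses \<open>q\<close> in the second coordinate and pauses at
      \<open>k\<close> to traverse \<open>p\<close> in the first, so its length is the optimal
      one.\<close>
    let ?w = "(g, h) # ?P @ ?R"
    have gv: "g \<in> pverts G" "g' \<in> pverts G" "h \<in> pverts H" using mem sub by auto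
    have "vwalk (?P @ ?R) (with_proj (cartesian_product G H))"
      using vwalk_layer_fst[OF vp(1) k(2)] vwalk_layer_snd[OF vr gv(2)] vp r arc' gv
      by (intro vwalk_append) (auto simp: hd_map last_map)
    then have "vwalk ?w (with_proj (cartesian_product G H))"
      using vp arc gv by (intro vwalk_consI) (auto simp: hd_map)
    then have "shortest_vpath (cartesian_product G H) (g, h) (g', h') ?w"
      using r q_eq
      by (intro shortest_vpath_cartesian_productI[OF assms(1,2) p(1) q(1)])
        (auto simp: last_map)
    moreover have "set ?w \<inter> S \<times> I = {(g, h), (g', h')}"
    proof -
      \<comment> \<open>The last leg keeps the first coordinate \<open>g'\<close>, which lies in
        \<open>S\<close>, so only the second coordinate can keep it out of the product.\<close>
      have "set r \<inter> I = {h'}"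
        using q(2) q_eq h r mem(4) last_in_set[of r] by auto
      then show ?thesis using k(1) mem by auto
    qed
    ultimately show ?thesis unfolding visible_def x y by blast
  qed
qed

section \<open>Exchanging the factors\<close>

lemma vwalk_swap:
  assumes "vwalk w (with_proj (cartesian_product G H))"
  shows "vwalk (map prod.swap w) (with_proj (cartesian_product H G))"
  using assms by (rule vwalk_map) auto

text \<open>Swapping coordinates is its own inverse and preserves walks, so a competitor on one side
  pulls back to an equally long one on the other.\<close>

lemma shortest_vpath_swap:
  assumes "shortest_vpath (cartesian_product G H) x y w"
  shows "shortest_vpath (cartesian_product H G) (prod.swap x) (prod.swap y) (map prod.swap w)"
proof -
  have "length w \<le> length r"
    if r: "vwalk r (with_proj (cartesian_product H G))"
      "hd r = prod.swap x" "last r = prod.swap y" for r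
  proof -
    have "r \<noteq> []" using r by auto
    then have "length w \<le> length (map prod.swap r)"
      using assms vwalk_swap[OF r(1)] r(2,3)
      unfolding shortest_vpath_iff by (simp add: hd_map last_map del: length_map)
    then show ?thesis by simp
  qed
  moreover have "w \<noteq> []" using assms by (auto simp: shortest_vpath_iff)
  ultimately show ?thesis
    using assms by (simp add: shortest_vpath_iff vwalk_swap hd_map last_map)
qed

lemma visible_swap:
  assumes "visible (cartesian_product G H) X x y"
  shows "visible (cartesian_product H G) (prod.swap ` X) (prod.swap x) (prod.swap y)"
proof -
  obtain w where w: "shortest_vpath (cartesian_product G H) x y w" "set w \<inter> X = {x, y}"
    using assms unfolding visible_def by blast
  have "set (map prod.swap w) \<inter> prod.swap ` X = prod.swap ` (set w \<inter> X)"
    by (simp only: set_map image_Int[OF inj_swap])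
  also have "\<dots> = {prod.swap x, prod.swap y}"
    by (simp only: w(2) image_insert image_empty)
  finally show ?thesis
    using shortest_vpath_swap[OF w(1)] unfolding visible_def by blast
qed

lemma mutual_visibility_set_swap:
  assumes "mutual_visibility_set (cartesian_product G H) X"
  shows "mutual_visibility_set (cartesian_product H G) (prod.swap ` X)"
  unfolding mutual_visibility_set_def
proof (intro conjI ballI)
  show "prod.swap ` X \<subseteq> pverts (cartesian_product H G)"
    using assms by (auto simp: mutual_visibility_set_def)
next
  fix x y assume "x \<in> prod.swap ` X" "y \<in> prod.swap ` X"
  then show "visible (cartesian_product H G) (prod.swap ` X) x y"
    using assms visible_swap unfolding mutual_visibility_set_def by blast
qed

section \<open>Bounds on \<open>mu\<close> of the product\<close>

lemma card_le_mu:
  assumes "finite (pverts G)" "mutual_visibility_set G X"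
  shows "card X \<le> mu G"
  unfolding mu_def using assms mutual_visibility_cards(1)[of G] by (intro Max_ge) auto

lemma mu_witness:
  assumes "finite (pverts G)"
  obtains X where "mutual_visibility_set G X" "card X = mu G"
  using Max_in[OF mutual_visibility_cards(1,2)[OF assms]] by (auto simp: mu_def)

lemma mu_i_witness:
  assumes "finite (pverts G)"
  obtains X where "independent_mutual_visibility_set G X" "card X = mu_i G"
  using Max_in[OF mutual_visibility_cards(3,4)[OF assms]] by (auto simp: mu_i_def)

lemma pair_graph_finite_pverts: "pair_graph G \<Longrightarrow> finite (pverts G)"
  by (simp add: pair_graph_def pair_digraph_def pair_fin_digraph.pair_finite_verts)

lemma mu_cartesian_product_swap_le:
  assumes "pair_graph G" "pair_graph H"
  shows "mu (cartesian_product G H) \<le> mu (cartesian_product H G)"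
proof -
  have fin: "finite (pverts G)" "finite (pverts H)"
    using assms by (auto intro: pair_graph_finite_pverts)
  then have "finite (pverts (cartesian_product G H))" by simp
  then obtain X where X: "mutual_visibility_set (cartesian_product G H) X"
    "card X = mu (cartesian_product G H)"
    by (rule mu_witness)
  have "card (prod.swap ` X) = card X" by (simp add: card_image)
  moreover have "card (prod.swap ` X) \<le> mu (cartesian_product H G)"
    using fin by (intro card_le_mu mutual_visibility_set_swap X) auto
  ultimately show ?thesis using X(2) by simp
qed

lemma mu_cartesian_product_commute:
  assumes "pair_graph G" "pair_graph H"
  shows "mu (cartesian_product G H) = mu (cartesian_product H G)"
  using assms by (intro antisym mu_cartesian_product_swap_le)

lemma mu_cartesian_product_le:
  assumes "pair_graph G" "pair_graph H"
  shows "mu (cartesian_product G H) \<le> mu G * card (pverts H)"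
proof -
  have fin: "finite (pverts G)" "finite (pverts H)"
    using assms by (auto intro: pair_graph_finite_pverts)
  then have "finite (pverts (cartesian_product G H))" by simp
  then obtain X where X: "mutual_visibility_set (cartesian_product G H) X"
    "card X = mu (cartesian_product G H)"
    by (rule mu_witness)
  let ?L = "\<lambda>h. {g. (g, h) \<in> X}"
  have sub: "X \<subseteq> pverts G \<times> pverts H"
    using X(1) by (simp add: mutual_visibility_set_def)
  then have finL: "finite (?L h)" for h
    by (intro finite_subset[OF _ fin(1)]) auto
  \<comment> \<open>The layers partition \<open>X\<close>; the swap is there because the dependent
    sum puts the index \<open>h\<close> first.\<close>
  have "bij_betw prod.swap (SIGMA h:pverts H. ?L h) X"
    using sub by (intro bij_betwI[where g = prod.swap]) auto
  then have "card X = card (SIGMA h:pverts H. ?L h)"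
    by (simp add: bij_betw_same_card)
  also have "\<dots> = (\<Sum>h\<in>pverts H. card (?L h))"
    using fin finL by simp
  also have "\<dots> \<le> (\<Sum>h\<in>pverts H. mu G)"
    using assms fin X(1) by (intro sum_mono card_le_mu mutual_visibility_set_layer)
  finally show ?thesis using X(2) by (simp add: mult.commute)
qed

lemma mu_cartesian_product_ge:
  assumes "pair_graph G" "pair_graph H"
  shows "mu G * mu_i H \<le> mu (cartesian_product G H)"
proof -
  have fin: "finite (pverts G)" "finite (pverts H)"
    using assms by (auto intro: pair_graph_finite_pverts)
  obtain S where S: "mutual_visibility_set G S" "card S = mu G"
    using fin(1) by (rule mu_witness)
  obtain I where I: "independent_mutual_visibility_set H I" "card I = mu_i H"
    using fin(2) by (rule mu_i_witness)
  have "card (S \<times> I) \<le> mu (cartesian_product G H)"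
    using fin by (intro card_le_mu mutual_visibility_set_Times assms S I) auto
  then show ?thesis using S I by (simp add: card_cartesian_product)
qed

theorem theorem3p2:
  fixes G :: "'a pair_pre_digraph" and H :: "'b pair_pre_digraph"
  assumes "pair_graph G" and "Digraph_Component.connected (with_proj G)"
    and "pair_graph H" and "Digraph_Component.connected (with_proj H)"
  shows "mu (cartesian_product G H) \<le> min (mu G * card (pverts H)) (mu H * card (pverts G)) \<and>
    mu (cartesian_product G H) \<ge> max (mu G * mu_i H) (mu H * mu_i G)"
  \<comment> \<open>The second terms of \<open>min\<close> and \<open>max\<close> are the bounds for
    the exchanged factors, carried over by commutativity.\<close>
  using assms(1,3) mu_cartesian_product_le[of G H] mu_cartesian_product_le[of H G]
    mu_cartesian_product_ge[of G H] mu_cartesian_product_ge[of H G]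
    mu_cartesian_product_commute[of G H]
  by simp

end
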